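(* Let $f_\theta$ be an encoder taking values in the unit sphere $\mathbb{S}^{d-1}=\{v\in\mathbb{R}^d:\|v\|=1\}$, so that $\|f_\theta(t(x))\|=1$ for every image $x$ and every transformation $t\in\mathcal{T}$. Let $T$ be a random transformation distributed over $\mathcal{T}$. Fix an image $x\in\mathcal{X}$ and a transformation $t\in\mathcal{T}$, assume $\mathbb{E}_T f_\theta(T(x))\neq 0$, and assume that $$f_\theta(t(x))\cdot \mathbb{E}_T f_\theta(T(x))\ \geq\ 0 .$$ Then, with $s$ denoting cosine similarity, $$-s\bigl(f_\theta(t(x)),\,\mathbb{E}_T f_\theta(T(x))\bigr)\ \leq\ -\mathbb{E}_T\, s\bigl(f_\theta(t(x)),\,f_\theta(T(x))\bigr).$$
   Context: $\mathcal{X}$ is a set of images and $\mathcal{T}$ is a set of transformations of images; the encoder $f_\theta$ (a map with parameters $\theta$, which are fixed here) is defined on all images $t(x)$ with $x\in\mathcal{X}$, $t\in\mathcal{T}$, and $f_\theta(T(x))$ is a random vector in $\mathbb{R}^d$ (measurability is assumed). $\mathbb{E}_T$ denotes expectation over $T$. The norm $\|\cdot\|$ is the Euclidean norm and $\cdot$ is the Euclidean inner product. Cosine similarity is $s(x_1,x_2)=\dfrac{x_1\cdot x_2}{\|x_1\|\,\|x_2\|}$ for nonzero $x_1,x_2\in\mathbb{R}^d$; whenever $s(x_1,x_2)$ is written, $x_1$ and $x_2$ are assumed to be nonzero. *)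

theory Defs
  imports "HOL-Probability.Probability"
begin

(* Meaningful for nonzero arguments only; since x / 0 = 0, the value is 0
   when one of the arguments is zero. *)
definition cosine_similarity :: "real ^ 'd \<Rightarrow> real ^ 'd \<Rightarrow> real" where
  "cosine_similarity v w = (v \<bullet> w) / (norm v * norm w)"

end

theory Submission
  imports Defs
begin

text \<open>Between unit vectors cosine similarity is the inner product, which is linear, so the
  mean similarity is \<open>?u \<bullet> ?m\<close>. The similarity to the mean is this same number
  divided by \<open>norm ?m\<close>. An average of unit vectors lies in the closed unit ball, so the
  division can only enlarge a nonnegative number.\<close>

theorem theorem4p4:
  fixes X :: "'i set"
    and TT :: "('i \<Rightarrow> 'i) set"
    and f :: "'i \<Rightarrow> real ^ 'd"
    and M :: "'w measure"
    and T :: "'w \<Rightarrow> 'i \<Rightarrow> 'i"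
    and x :: 'i
    and t :: "'i \<Rightarrow> 'i"
  assumes "prob_space M"
    and "\<And>\<omega>. \<omega> \<in> space M \<Longrightarrow> T \<omega> \<in> TT"
    and "\<And>y. y \<in> X \<Longrightarrow> prob_space.random_variable M borel (\<lambda>\<omega>. f (T \<omega> y))"
    and "\<And>y u. y \<in> X \<Longrightarrow> u \<in> TT \<Longrightarrow> f (u y) \<in> sphere 0 1"
    and "x \<in> X"
    and "t \<in> TT"
    and "prob_space.expectation M (\<lambda>\<omega>. f (T \<omega> x)) \<noteq> 0"
    and "f (t x) \<bullet> prob_space.expectation M (\<lambda>\<omega>. f (T \<omega> x)) \<ge> 0"
  shows "- cosine_similarity (f (t x)) (prob_space.expectation M (\<lambda>\<omega>. f (T \<omega> x)))
         \<le> - prob_space.expectation M (\<lambda>\<omega>. cosine_similarity (f (t x)) (f (T \<omega> x)))"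
proof -
  interpret prob_space M by fact
  let ?u = "f (t x)"
  let ?F = "\<lambda>\<omega>. f (T \<omega> x)"
  let ?m = "expectation ?F"
  have norm_F: "norm (?F \<omega>) = 1" if "\<omega> \<in> space M" for \<omega>
    using assms(2,4,5) that by auto
  have norm_u: "norm ?u = 1"
    using assms(4-6) by auto
  \<comment> \<open>A bounded measurable map on a probability space is integrable; this is what lets
    the expectation be moved inside the inner product with \<open>?u\<close> below.\<close>
  have int_F: "integrable M ?F"
    using assms(3,5) norm_F by (intro integrable_const_bound[where B = 1]) auto
  have "norm ?m \<le> expectation (\<lambda>\<omega>. norm (?F \<omega>))"
    by (rule integral_norm_bound)
  also have "\<dots> = expectation (\<lambda>\<omega>. 1)"
    by (intro Bochner_Integration.integral_cong) (simp_all add: norm_F)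
  also have "\<dots> = 1"
    by (simp add: prob_space)
  finally have norm_m: "norm ?m \<le> 1" .
  have "expectation (\<lambda>\<omega>. cosine_similarity ?u (?F \<omega>)) = expectation (\<lambda>\<omega>. ?u \<bullet> ?F \<omega>)"
    by (intro Bochner_Integration.integral_cong)
      (simp_all add: cosine_similarity_def norm_u norm_F)
  also have "\<dots> = ?u \<bullet> ?m"
    using int_F by simp
  \<comment> \<open>The sign hypothesis enters here: dividing by \<open>norm ?m\<close>, which lies
    in (0, 1], would decrease a negative numerator if \<open>norm ?m < 1\<close>.\<close>
  also have "\<dots> \<le> (?u \<bullet> ?m) / norm ?m"
    using assms(7,8) norm_m by (simp add: le_divide_eq mult_left_le)
  also have "\<dots> = cosine_similarity ?u ?m"
    by (simp add: cosine_similarity_def norm_u)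
  finally show ?thesis
    by simp
qed

end
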